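(* As formal power series in $y$, \[ \sum_{n\ge 0}Q_n(x)y^n=\frac{1+(1+x)y-(1+x)^2y^3-(1+x)^2y^4}{1-y-(1+x)y^2}. \]
   Context: For $n\ge 0$, the $S$-fence $\phi_n$ is the poset on $\{x_1,\dots,x_n\}$ whose order is generated by the cover relations $x_2<x_1$, $x_3<x_2$, $x_2<x_4$, $x_5<x_4$, and, for every $i\ge 3$, $x_{2i-1}<x_{2i}$ and $x_{2i+1}<x_{2i}$, keeping only those relations whose elements both have index $\le n$ ($\phi_0$ is empty, and $\Phi_0$ is a single vertex). A filter is an up-set. $\Phi_n$ is the underlying undirected graph of the Hasse diagram of the lattice of filters of $\phi_n$ ordered by reverse inclusion (two filters adjacent iff they differ in exactly one element). $q_{n,k}$ is the number of induced subgraphs of $\Phi_n$ isomorphic to the hypercube $Q_k$, and $Q_n(x)=\sum_{k\ge0}q_{n,k}x^k$. *)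

theory Defs
  imports
    "HOL-Computational_Algebra.Computational_Algebra"
    "Graph_Theory.Pair_Digraph"
    "Graph_Theory.Digraph_Isomorphism"
begin

text \<open>Element \<open>x\<^sub>i\<close> of the fence is represented by its index \<open>i\<close>;
  a pair \<open>(i, j)\<close> stands for \<open>x\<^sub>i < x\<^sub>j\<close> (resp. \<open>x\<^sub>i \<le> x\<^sub>j\<close>).\<close>

definition fence_covers :: "nat rel" where
  "fence_covers = {(2, 1), (3, 2), (2, 4), (5, 4)} \<union> (\<Union>i\<in>{3..}. {(2*i - 1, 2*i), (2*i + 1, 2*i)})"

definition fence_le :: "nat \<Rightarrow> nat rel" where
  "fence_le n = Restr ((Restr fence_covers {1..n})\<^sup>*) {1..n}"

definition fence_filters :: "nat \<Rightarrow> nat set set" where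
  "fence_filters n = {F. F \<subseteq> {1..n} \<and> (\<forall>i\<in>F. \<forall>j. (i, j) \<in> fence_le n \<longrightarrow> j \<in> F)}"

definition hasse_diagram :: "('a \<Rightarrow> 'a \<Rightarrow> bool) \<Rightarrow> 'a set \<Rightarrow> 'a pair_pre_digraph" where
  "hasse_diagram lt A =
     \<lparr> pverts = A,
       parcs = {(a, b). a \<in> A \<and> b \<in> A \<and> lt a b \<and> \<not> (\<exists>c\<in>A. lt a c \<and> lt c b)} \<rparr>"

text \<open>Undirected graphs are symmetric digraphs, each edge being a pair of opposite arcs.
  Reverse inclusion makes \<open>G\<close> larger than \<open>F\<close> when \<open>G \<subset> F\<close>.\<close>

definition fence_graph :: "nat \<Rightarrow> nat set pair_pre_digraph" where
  "fence_graph n = mk_symmetric (with_proj (hasse_diagram (\<lambda>F G. G \<subset> F) (fence_filters n)))"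

text \<open>Binary words of length \<open>k\<close> are encoded by the set of positions of their ones.\<close>

definition hypercube :: "nat \<Rightarrow> nat set pair_pre_digraph" where
  "hypercube k =
     \<lparr> pverts = Pow {..<k},
       parcs = {(A, B). A \<subseteq> {..<k} \<and> B \<subseteq> {..<k} \<and> card (sym_diff A B) = 1} \<rparr>"

definition cube_count :: "nat \<Rightarrow> nat \<Rightarrow> nat" where
  "cube_count n k =
     card {H. induced_subgraph H (with_proj (fence_graph n)) \<and>
              digraph_iso H (with_proj (hypercube k))}"

text \<open>The sum over all \<open>k\<close> has finite support, as \<open>finite_cube_count_support\<close> below shows.\<close>

definition cube_poly :: "nat \<Rightarrow> int poly" where
  "cube_poly n = (\<Sum>k | cube_count n k \<noteq> 0. monom (int (cube_count n k)) k)"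

lemma pverts_fence_graph [simp]: "pverts (fence_graph n) = fence_filters n"
  by (simp add: fence_graph_def mk_symmetric_def hasse_diagram_def)

lemma finite_fence_filters: "finite (fence_filters n)"
  by (rule finite_subset[of _ "Pow {1..n}"]) (auto simp: fence_filters_def)

lemma finite_cube_count_support: "finite {k. cube_count n k \<noteq> 0}"
proof -
  have "k \<le> card (fence_filters n)" if "cube_count n k \<noteq> 0" for k
  proof -
    from that have "{H. induced_subgraph H (with_proj (fence_graph n)) \<and>
        digraph_iso H (with_proj (hypercube k))} \<noteq> {}"
      unfolding cube_count_def by (metis card.empty)
    then obtain H where H: "induced_subgraph H (with_proj (fence_graph n))"
      "digraph_iso H (with_proj (hypercube k))" by blast
    from H(1) have sub: "verts H \<subseteq> fence_filters n"
      by (auto simp: induced_subgraph_def subgraph_def)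
    from H(2) obtain f where f: "with_proj (hypercube k) = app_iso f H"
      unfolding digraph_iso_def by blast
    then have "verts (with_proj (hypercube k)) = iso_verts f ` verts H"
      by simp
    then have "Pow {..<k} = iso_verts f ` verts H"
      by (simp add: hypercube_def)
    then have "2 ^ k \<le> card (verts H)"
      using card_image_le[of "verts H" "iso_verts f"] finite_subset[OF sub finite_fence_filters]
      by (metis card_Pow card_lessThan finite_lessThan)
    also have "\<dots> \<le> card (fence_filters n)"
      by (rule card_mono[OF finite_fence_filters sub])
    finally show ?thesis
      using less_exp[of k] by linarith
  qed
  then show ?thesis
    by - (rule finite_subset[of _ "{..card (fence_filters n)}"], auto)
qed

lemma coeff_cube_poly: "coeff (cube_poly n) k = int (cube_count n k)"
proof -
  have "coeff (cube_poly n) k =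
      (\<Sum>j | cube_count n j \<noteq> 0. if j = k then int (cube_count n j) else 0)"
    by (simp add: cube_poly_def coeff_sum)
  then show ?thesis
    using finite_cube_count_support[of n] by (simp add: sum.delta)
qed

lemma finite_nat_minimal:
  fixes r :: "'a \<Rightarrow> nat"
  assumes "finite D" "D \<noteq> {}"
  shows "\<exists>x\<in>D. \<forall>y\<in>D. r x \<le> r y"
  using assms by (meson arg_min_if_finite(1) arg_min_least)

definition fence_rank :: "nat \<Rightarrow> nat" where
  "fence_rank i = (if i = 1 \<or> i = 4 then 2 else if i = 2 then 1
     else if i = 3 then 0 else if even i then 1 else 0)"

lemma fence_rank_covers: "(i, j) \<in> fence_covers \<Longrightarrow> fence_rank i < fence_rank j"
  by (auto simp: fence_covers_def fence_rank_def)

lemma fence_rank_le: "(i, j) \<in> fence_le n \<Longrightarrow> i = j \<or> fence_rank i < fence_rank j"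
proof -
  assume "(i, j) \<in> fence_le n"
  then have "(i, j) \<in> (Restr fence_covers {1..n})\<^sup>*" by (simp add: fence_le_def)
  then show ?thesis
    by (induction rule: rtrancl_induct) (auto dest: fence_rank_covers)
qed

lemma fence_filter_remove:
  assumes F: "F \<in> fence_filters n" and G: "G \<in> fence_filters n" and "G \<subset> F"
  shows "\<exists>x\<in>F - G. F - {x} \<in> fence_filters n"
proof -
  have "F \<subseteq> {1..n}" using F by (simp add: fence_filters_def)
  then have "finite (F - G)" by (meson finite_Diff finite_subset finite_atLeastAtMost)
  moreover have "F - G \<noteq> {}" using assms by blast
  ultimately obtain x where x: "x \<in> F - G" "\<forall>y\<in>F - G. fence_rank x \<le> fence_rank y"
    using finite_nat_minimal by metis
  have "j \<noteq> x" if "i \<in> F - {x}" "(i, j) \<in> fence_le n" for i j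
  proof
    assume "j = x"
    with that fence_rank_le have lt: "fence_rank i < fence_rank x" by blast
    show False
    proof (cases "i \<in> G")
      case True
      then have "x \<in> G" using G that \<open>j = x\<close> by (auto simp: fence_filters_def)
      then show False using x by simp
    next
      case False
      then show False using x that lt by (meson DiffD1 DiffI leD)
    qed
  qed
  then have "F - {x} \<in> fence_filters n"
    using F unfolding fence_filters_def by blast
  then show ?thesis using x by blast
qed

lemma sym_diff_singleton:
  assumes "card (sym_diff A B) = 1"
  shows "(\<exists>x. x \<in> A \<and> B = A - {x}) \<or> (\<exists>x. x \<in> B \<and> A = B - {x})"
proof -
  obtain x where x: "sym_diff A B = {x}" using assms card_1_singletonE by blast
  then have "x \<in> sym_diff A B" by (rule equalityD2[THEN subsetD]) (rule singletonI)
  then consider "x \<in> A" "x \<notin> B" | "x \<in> B" "x \<notin> A" by (elim UnE DiffE)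
  then show ?thesis
  proof cases
    case 1
    have "A - B \<subseteq> {x}" "B - A \<subseteq> {x}" unfolding x[symmetric] by (rule Un_upper1, rule Un_upper2)
    with 1 have "B = A - {x}" by blast
    with 1 show ?thesis by metis
  next
    case 2
    have "A - B \<subseteq> {x}" "B - A \<subseteq> {x}" unfolding x[symmetric] by (rule Un_upper1, rule Un_upper2)
    with 2 have "A = B - {x}" by blast
    with 2 show ?thesis by metis
  qed
qed

lemma hasse_fence_iff:
  assumes F: "F \<in> fence_filters n" and G: "G \<in> fence_filters n"
  shows "(F, G) \<in> parcs (hasse_diagram (\<lambda>F G. G \<subset> F) (fence_filters n)) \<longleftrightarrow>
    (\<exists>x\<in>F. G = F - {x})"
proof
  assume "(F, G) \<in> parcs (hasse_diagram (\<lambda>F G. G \<subset> F) (fence_filters n))"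
  then have *: "G \<subset> F" "\<not> (\<exists>H\<in>fence_filters n. H \<subset> F \<and> G \<subset> H)"
    by (auto simp: hasse_diagram_def)
  obtain x where x: "x \<in> F - G" "F - {x} \<in> fence_filters n"
    using fence_filter_remove[OF F G *(1)] by blast
  then have "F - {x} \<subset> F" by blast
  with * x have "\<not> G \<subset> F - {x}" by blast
  then have "G = F - {x}" using x *(1) by blast
  then show "\<exists>x\<in>F. G = F - {x}" using x by blast
next
  assume "\<exists>x\<in>F. G = F - {x}"
  then show "(F, G) \<in> parcs (hasse_diagram (\<lambda>F G. G \<subset> F) (fence_filters n))"
    using F G unfolding hasse_diagram_def by auto
qed

lemma parcs_fence_graph:
  "parcs (fence_graph n) =
     {(F, G). F \<in> fence_filters n \<and> G \<in> fence_filters n \<and> card (sym_diff F G) = 1}"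
proof -
  let ?D = "hasse_diagram (\<lambda>F G. G \<subset> F) (fence_filters n)"
  have D: "(F, G) \<in> parcs ?D \<Longrightarrow> F \<in> fence_filters n \<and> G \<in> fence_filters n" for F G
    by (auto simp: hasse_diagram_def)
  have "parcs (fence_graph n) = (\<Union>(A, B)\<in>parcs ?D. {(A, B), (B, A)})"
    by (simp add: fence_graph_def mk_symmetric_def case_prod_beta)
  then have E: "(F, G) \<in> parcs (fence_graph n) \<longleftrightarrow> (F, G) \<in> parcs ?D \<or> (G, F) \<in> parcs ?D" for F G
    by auto
  have "(F, G) \<in> parcs (fence_graph n) \<longleftrightarrow>
      F \<in> fence_filters n \<and> G \<in> fence_filters n \<and> card (sym_diff F G) = 1" for F G
  proof (cases "F \<in> fence_filters n \<and> G \<in> fence_filters n")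
    case True
    have 1: "card (sym_diff A (A - {x})) = 1 \<and> card (sym_diff (A - {x}) A) = 1"
      if "x \<in> A" for A and x :: nat
    proof -
      have "sym_diff A (A - {x}) = {x}" "sym_diff (A - {x}) A = {x}" using that by auto
      then show ?thesis by simp
    qed
    have "(F, G) \<in> parcs (fence_graph n) \<longleftrightarrow> (\<exists>x\<in>F. G = F - {x}) \<or> (\<exists>x\<in>G. F = G - {x})"
      using True by (simp only: E hasse_fence_iff)
    also have "\<dots> \<longleftrightarrow> card (sym_diff F G) = 1"
    proof
      assume "(\<exists>x\<in>F. G = F - {x}) \<or> (\<exists>x\<in>G. F = G - {x})"
      then show "card (sym_diff F G) = 1" by (elim disjE bexE) (simp_all only: 1)
    next
      assume "card (sym_diff F G) = 1"
      from sym_diff_singleton[OF this]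
      show "(\<exists>x\<in>F. G = F - {x}) \<or> (\<exists>x\<in>G. F = G - {x})" by (simp only: Bex_def)
    qed
    finally show ?thesis using True by simp
  next
    case False
    then show ?thesis using D E by blast
  qed
  then show ?thesis by (simp only: set_eq_iff split_paired_All mem_Collect_eq prod.case simp_thms)
qed

end

theory Submission
  imports Defs
begin

text \<open>An injective adjacency-preserving map from a hypercube into a family of sets, adjacent when
  they differ in one element, has a subcube \<open>{A \<union> E | E \<subseteq> D}\<close> with \<open>A \<inter> D = {}\<close> as its image, so
  the copies of \<open>Q\<^sub>k\<close> in \<open>\<Phi>\<^sub>n\<close> are the pairs \<open>(A, D)\<close> with \<open>|D| = k\<close> whose subcube consists of
  filters. For a fixed element \<open>a\<close>, such a pair has \<open>a\<close> outside \<open>A \<union> D\<close>, in \<open>A\<close> or in \<open>D\<close>.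
  Taking \<open>a = x\<^sub>n\<close>, for \<open>n \<ge> 5\<close> the filters with and without \<open>x\<^sub>n\<close> are copies of the filters of
  \<open>\<phi>\<^bsub>n-1\<^esub>\<close> and \<open>\<phi>\<^bsub>n-2\<^esub>\<close> (in one order or the other, by the parity of \<open>n\<close>), nested in each other
  up to removing \<open>x\<^sub>n\<close>. Hence \<open>Q\<^sub>n = Q\<^bsub>n-1\<^esub> + (1 + x) Q\<^bsub>n-2\<^esub>\<close>, and the numerator comes from \<open>n \<le> 4\<close>.\<close>

section \<open>Subcubes in families of sets\<close>

text \<open>The Boolean interval between \<open>A\<close> and \<open>A \<union> D\<close>:
  \<open>A\<close> is its bottom vertex and \<open>D\<close> its set of directions.\<close>

definition subcube :: "'a set \<Rightarrow> 'a set \<Rightarrow> 'a set set" where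
  "subcube A D = (\<union>) A ` Pow D"

text \<open>Disjointness makes the pair unique for its subcube, so counting pairs counts subcubes;
  for finite \<open>D\<close> the dimension is \<open>card D\<close>.\<close>

definition cubes :: "'a set set \<Rightarrow> ('a set \<times> 'a set) set" where
  "cubes \<F> = {(A, D). A \<inter> D = {} \<and> subcube A D \<subseteq> \<F>}"

definition family_cube_poly :: "'a set set \<Rightarrow> int poly" where
  "family_cube_poly \<F> = (\<Sum>(A, D)\<in>cubes \<F>. monom 1 (card D))"

lemma mem_cubes: "(A, D) \<in> cubes \<F> \<longleftrightarrow> A \<inter> D = {} \<and> (\<forall>E\<subseteq>D. A \<union> E \<in> \<F>)"
  by (auto simp: cubes_def subcube_def)

lemma finite_cubes:
  assumes "finite (\<Union>\<F>)"
  shows "finite (cubes \<F>)"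
proof (rule finite_subset)
  show "cubes \<F> \<subseteq> Pow (\<Union>\<F>) \<times> Pow (\<Union>\<F>)"
  proof clarify
    fix A D assume "(A, D) \<in> cubes \<F>"
    then have "A \<union> {} \<in> \<F>" "A \<union> D \<in> \<F>" unfolding mem_cubes by blast+
    then show "A \<in> Pow (\<Union>\<F>) \<and> D \<in> Pow (\<Union>\<F>)" by blast
  qed
qed (use assms in simp)

lemma finite_cube_direction:
  assumes "finite (\<Union>\<F>)" "(A, D) \<in> cubes \<F>"
  shows "finite D"
proof -
  have "A \<union> D \<in> \<F>" using assms(2) unfolding mem_cubes by blast
  then show ?thesis using assms(1) by (meson Sup_upper Un_subset_iff finite_subset)
qed

text \<open>Along a cube, \<open>a\<close> is constantly absent, constantly present, or a direction.
  In the last case the facets without and with \<open>a\<close> both lie in \<open>\<F>\<close>, so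
  the facet without \<open>a\<close> is a cube of sets that stay in \<open>\<F>\<close> when
  \<open>a\<close> is added.\<close>

lemma cubes_split:
  fixes a :: 'a
  shows "cubes \<F> = cubes {X \<in> \<F>. a \<notin> X}
    \<union> (\<lambda>(A, D). (insert a A, D)) ` cubes {X. a \<notin> X \<and> insert a X \<in> \<F>}
    \<union> (\<lambda>(A, D). (A, insert a D)) ` cubes {X \<in> \<F>. a \<notin> X \<and> insert a X \<in> \<F>}"
    (is "_ = ?P \<union> ?Q \<union> ?R")
proof (rule set_eqI, clarify)
  fix A D
  show "(A, D) \<in> cubes \<F> \<longleftrightarrow> (A, D) \<in> ?P \<union> ?Q \<union> ?R"
  proof
    assume *: "(A, D) \<in> cubes \<F>"
    then have AD: "A \<inter> D = {}" and F: "\<And>E. E \<subseteq> D \<Longrightarrow> A \<union> E \<in> \<F>"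
      unfolding mem_cubes by auto
    consider "a \<in> A" | "a \<in> D" | "a \<notin> A" "a \<notin> D" by blast
    then show "(A, D) \<in> ?P \<union> ?Q \<union> ?R"
    proof cases
      case 1
      have "insert a (A - {a} \<union> E) = A \<union> E" for E using 1 by blast
      then have "(A - {a}, D) \<in> cubes {X. a \<notin> X \<and> insert a X \<in> \<F>}"
        unfolding mem_cubes using 1 AD F by auto
      then show ?thesis using 1 by (intro UnI1 UnI2 image_eqI[of _ _ "(A - {a}, D)"]) auto
    next
      case 2
      have "insert a (A \<union> E) \<in> \<F>" if "E \<subseteq> D" for E
        using F[of "insert a E"] 2 that by simp
      then have "(A, D - {a}) \<in> cubes {X \<in> \<F>. a \<notin> X \<and> insert a X \<in> \<F>}"
        unfolding mem_cubes using 2 AD F by auto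
      then show ?thesis using 2 by (intro UnI2 image_eqI[of _ _ "(A, D - {a})"]) auto
    next
      case 3
      then have "(A, D) \<in> ?P" unfolding mem_cubes using AD F by auto
      then show ?thesis by blast
    qed
  next
    assume "(A, D) \<in> ?P \<union> ?Q \<union> ?R"
    then consider "(A, D) \<in> ?P" | "(A, D) \<in> ?Q" | "(A, D) \<in> ?R" by blast
    then show "(A, D) \<in> cubes \<F>"
    proof cases
      case 1
      then show ?thesis by (auto simp: mem_cubes)
    next
      case 2
      then obtain B where B: "A = insert a B" "(B, D) \<in> cubes {X. a \<notin> X \<and> insert a X \<in> \<F>}"
        by auto
      then have "a \<notin> B \<union> D" unfolding mem_cubes by blast
      with B show ?thesis unfolding mem_cubes by auto
    next
      case 3
      then obtain E where E: "D = insert a E"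
          "(A, E) \<in> cubes {X \<in> \<F>. a \<notin> X \<and> insert a X \<in> \<F>}"
        by auto
      then have a: "a \<notin> A \<union> E" unfolding mem_cubes by blast
      \<comment> \<open>A vertex containing \<open>a\<close> is in the upper facet, and dropping
        \<open>a\<close> gives a vertex of the lower one.\<close>
      have "A \<union> B \<in> \<F>" if "B \<subseteq> insert a E" for B
      proof (cases "a \<in> B")
        case True
        then have "A \<union> B = insert a (A \<union> (B - {a}))" by blast
        moreover have "B - {a} \<subseteq> E" using that by blast
        ultimately show ?thesis using E(2) unfolding mem_cubes by auto
      next
        case False
        then have "B \<subseteq> E" using that by blast
        then show ?thesis using E(2) unfolding mem_cubes by auto
      qed
      then show ?thesis using E a unfolding mem_cubes by auto
    qed
  qed
qed

lemma notin_cube: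
  assumes "(A, D) \<in> cubes \<F>" "\<And>X. X \<in> \<F> \<Longrightarrow> a \<notin> X"
  shows "a \<notin> A" "a \<notin> D"
  using assms unfolding mem_cubes by blast+

text \<open>\<open>\<F>0\<close> is the deletion of \<open>a\<close> and \<open>\<F>1\<close> its
  link. Dropping \<open>a\<close> maps each of the three kinds of cubes injectively to cubes of
  these families or of their intersection. The dimension falls by one exactly when \<open>a\<close>
  is a direction, whence the factor \<open>[:0, 1:]\<close>, that is, x.\<close>

lemma family_cube_poly_split:
  fixes a :: 'a
  assumes fin: "finite (\<Union>\<F>)"
    and F0: "\<F>0 = {X \<in> \<F>. a \<notin> X}" and F1: "\<F>1 = {X. a \<notin> X \<and> insert a X \<in> \<F>}"
  shows "family_cube_poly \<F> =
    family_cube_poly \<F>0 + family_cube_poly \<F>1 + [:0, 1:] * family_cube_poly (\<F>0 \<inter> \<F>1)"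
proof -
  let ?w = "\<lambda>(A, D). monom 1 (card D) :: int poly"
  let ?Q = "(\<lambda>(A, D). (insert a A, D)) ` cubes \<F>1"
  let ?R = "(\<lambda>(A, D). (A, insert a D)) ` cubes (\<F>0 \<inter> \<F>1)"
  have F01: "\<F>0 \<inter> \<F>1 = {X \<in> \<F>. a \<notin> X \<and> insert a X \<in> \<F>}" using F0 F1 by blast
  have split: "cubes \<F> = cubes \<F>0 \<union> ?Q \<union> ?R"
    by (unfold F01, unfold F0 F1, rule cubes_split)
  have n0: "a \<notin> A \<and> a \<notin> D" if "(A, D) \<in> cubes \<F>0" for A D
    using notin_cube[OF that, of a] F0 by blast
  have n1: "a \<notin> A \<and> a \<notin> D" if "(A, D) \<in> cubes \<F>1" for A D
    using notin_cube[OF that, of a] F1 by blast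
  have n2: "a \<notin> A \<and> a \<notin> D" if "(A, D) \<in> cubes (\<F>0 \<inter> \<F>1)" for A D
    using notin_cube[OF that, of a] F1 by blast
  have "finite (\<Union>\<F>1)"
    by (rule finite_subset[OF _ fin]) (auto simp: F1)
  then have fin1: "finite (cubes \<F>1)" by (rule finite_cubes)
  have "finite (\<Union>\<F>0)"
    by (rule finite_subset[OF _ fin]) (auto simp: F0)
  then have fin0: "finite (cubes \<F>0)" by (rule finite_cubes)
  have fu2: "finite (\<Union>(\<F>0 \<inter> \<F>1))"
    by (rule finite_subset[OF _ fin]) (auto simp: F0)
  then have fin2: "finite (cubes (\<F>0 \<inter> \<F>1))" by (rule finite_cubes)
  have inj1: "inj_on (\<lambda>(A, D). (insert a A, D)) (cubes \<F>1)"
    by (auto simp: inj_on_def dest: n1)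
  have inj2: "inj_on (\<lambda>(A, D). (A, insert a D)) (cubes (\<F>0 \<inter> \<F>1))"
    by (auto simp: inj_on_def dest: n2)
  have "family_cube_poly \<F> = sum ?w (cubes \<F>0 \<union> ?Q \<union> ?R)"
    unfolding family_cube_poly_def by (simp only: split)
  also have "\<dots> = sum ?w (cubes \<F>0) + sum ?w ?Q + sum ?w ?R"
  proof -
    \<comment> \<open>The position of \<open>a\<close>, in neither component, in the first or in the
      second, keeps the parts apart.\<close>
    have "cubes \<F>0 \<inter> ?Q = {}" "(cubes \<F>0 \<union> ?Q) \<inter> ?R = {}"
      by (auto dest: n0 n1 n2)
    then show ?thesis using fin0 fin1 fin2 by (simp add: sum.union_disjoint)
  qed
  also have "sum ?w ?Q = family_cube_poly \<F>1"
    unfolding family_cube_poly_def sum.reindex[OF inj1] by (intro sum.cong) auto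
  also have "sum ?w ?R = [:0, 1:] * family_cube_poly (\<F>0 \<inter> \<F>1)"
    unfolding family_cube_poly_def sum.reindex[OF inj2] sum_distrib_left
  proof (intro sum.cong refl)
    fix p assume "p \<in> cubes (\<F>0 \<inter> \<F>1)"
    moreover obtain A D where p: "p = (A, D)" by (cases p)
    ultimately have *: "(A, D) \<in> cubes (\<F>0 \<inter> \<F>1)" by simp
    \<comment> \<open>Finiteness of \<open>D\<close> matters: an infinite set has
      \<open>card\<close> 0.\<close>
    then have "card (insert a D) = Suc (card D)"
      using n2[OF *] finite_cube_direction[OF fu2 *] by simp
    then show "(?w \<circ> (\<lambda>(A, D). (A, insert a D))) p = [:0, 1:] * ?w p"
      by (simp add: p monom_Suc)
  qed
  finally show ?thesis by (simp add: family_cube_poly_def)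
qed

lemma family_cube_poly_empty: "family_cube_poly ({} :: 'a set set) = 0"
proof -
  have "cubes ({} :: 'a set set) = {}" by (auto simp: cubes_def subcube_def)
  then show ?thesis by (simp add: family_cube_poly_def)
qed

text \<open>Splitting at \<open>a\<close> leaves an empty deletion and the link \<open>\<F>\<close>,
  so only the link term survives.\<close>

lemma family_cube_poly_insert:
  assumes "finite (\<Union>\<F>)" "\<And>X. X \<in> \<F> \<Longrightarrow> a \<notin> X"
  shows "family_cube_poly (insert a ` \<F>) = family_cube_poly \<F>"
proof -
  have "{} = {X \<in> insert a ` \<F>. a \<notin> X}" by blast
  moreover have "\<F> = {X. a \<notin> X \<and> insert a X \<in> insert a ` \<F>}"
    using assms(2) by (auto simp: image_iff) (metis Diff_insert_absorb Diff_insert2 insert_ident)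
  moreover have "finite (\<Union>(insert a ` \<F>))"
    by (rule finite_subset[of _ "insert a (\<Union>\<F>)"]) (use assms(1) in auto)
  ultimately show ?thesis
    using family_cube_poly_split[of "insert a ` \<F>" "{}" a \<F>] by (simp add: family_cube_poly_empty)
qed

lemma family_cube_poly_singleton: "family_cube_poly {A} = 1"
proof -
  have "cubes {A} = {(A, {})}"
  proof (rule set_eqI, clarify)
    fix B D
    have "B \<union> {} = A" "B \<union> D = A" if "(B, D) \<in> cubes {A}"
      using that unfolding mem_cubes by blast+
    then show "(B, D) \<in> cubes {A} \<longleftrightarrow> (B, D) \<in> {(A, {})}"
      by (auto simp: mem_cubes)
  qed
  then show ?thesis by (simp add: family_cube_poly_def)
qed

lemma coeff_family_cube_poly:
  assumes "finite (\<Union>\<F>)"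
  shows "coeff (family_cube_poly \<F>) k = int (card {(A, D) \<in> cubes \<F>. card D = k})"
proof -
  have "coeff (family_cube_poly \<F>) k = (\<Sum>p\<in>cubes \<F>. if card (snd p) = k then 1 else 0)"
    unfolding family_cube_poly_def coeff_sum by (intro sum.cong) auto
  also have "\<dots> = int (card (cubes \<F> \<inter> {p. card (snd p) = k}))"
    using finite_cubes[OF assms] by (simp add: sum.If_cases)
  also have "cubes \<F> \<inter> {p. card (snd p) = k} = {(A, D) \<in> cubes \<F>. card D = k}" by auto
  finally show ?thesis .
qed

section \<open>Induced hypercubes are subcubes\<close>

text \<open>Toggling elements of \<open>D\<close> changes \<open>A0\<close> only inside
  \<open>D\<close>, and \<open>E \<mapsto> sym_diff (A0 \<inter> D) E\<close> permutes the subsets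
  of \<open>D\<close>. This passes from a cube seen from any vertex \<open>A0\<close> to the same
  cube seen from its bottom.\<close>

lemma sym_diff_subcube:
  "sym_diff A0 ` Pow D = subcube (A0 - D) D"
proof
  show "sym_diff A0 ` Pow D \<subseteq> subcube (A0 - D) D"
  proof
    fix X assume "X \<in> sym_diff A0 ` Pow D"
    then obtain E where E: "E \<subseteq> D" "X = sym_diff A0 E" by blast
    then have "X = (A0 - D) \<union> sym_diff (A0 \<inter> D) E" by blast
    moreover have "sym_diff (A0 \<inter> D) E \<subseteq> D" using E by blast
    ultimately show "X \<in> subcube (A0 - D) D" unfolding subcube_def by blast
  qed
  show "subcube (A0 - D) D \<subseteq> sym_diff A0 ` Pow D"
  proof
    fix X assume "X \<in> subcube (A0 - D) D"
    then obtain E where E: "E \<subseteq> D" "X = (A0 - D) \<union> E" unfolding subcube_def by blast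
    then have "X = sym_diff A0 (sym_diff (A0 \<inter> D) E)" by blast
    moreover have "sym_diff (A0 \<inter> D) E \<subseteq> D" using E by blast
    ultimately show "X \<in> sym_diff A0 ` Pow D" by blast
  qed
qed

lemma card_sym_diff_1_obtain:
  assumes "card (sym_diff X Y) = 1"
  obtains u where "Y = sym_diff X {u}"
proof -
  obtain u where "sym_diff X Y = {u}" using assms card_1_singletonE by blast
  then have "Y = sym_diff X {u}" by (auto simp: set_eq_iff)
  then show ?thesis using that by blast
qed

text \<open>Cancelling \<open>P\<close> leaves \<open>sym_diff {a} {u} = sym_diff {b} {v}\<close>:
  either both sides are empty, or they are the same pair, with \<open>u = b\<close> and
  \<open>v = a\<close>.\<close>

lemma sym_diff_common_neighbour:
  assumes "sym_diff (sym_diff P {a}) {u} = sym_diff (sym_diff P {b}) {v}" "a \<noteq> b"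
  shows "sym_diff (sym_diff P {a}) {u} = P \<or> u = b"
proof (rule disjCI)
  assume "u \<noteq> b"
  then have "v = b" using assms by (auto simp: set_eq_iff split: if_splits)
  then have "sym_diff (sym_diff P {b}) {v} = P" by blast
  then show "sym_diff (sym_diff P {a}) {u} = P" using assms(1) by simp
qed

lemma sym_diff_insert:
  "a \<notin> X \<Longrightarrow> sym_diff P (insert a X) = sym_diff (sym_diff P X) {a}"
  by blast

text \<open>Two vertices at distance two have only two common neighbours, so the images of the
  empty set and of the singletons determine all others.\<close>

lemma hypercube_embedding:
  fixes f :: "'a set \<Rightarrow> 'b set"
  assumes K: "finite K" and inj: "inj_on f (Pow K)"
    and adj: "\<And>A B. A \<subseteq> K \<Longrightarrow> B \<subseteq> K \<Longrightarrow> card (sym_diff A B) = 1 \<Longrightarrow>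
      card (sym_diff (f A) (f B)) = 1"
  shows "\<exists>A D. A \<inter> D = {} \<and> card D = card K \<and> f ` Pow K = subcube A D"
proof -
  have adj': "\<exists>u. f (insert i B) = sym_diff (f B) {u}" if "insert i B \<subseteq> K" "i \<notin> B" for i B
  proof -
    have "sym_diff B (insert i B) = {i}" using that by blast
    then have "card (sym_diff B (insert i B)) = 1" by simp
    then show ?thesis using adj[of B "insert i B"] that by (meson card_sym_diff_1_obtain insert_subset)
  qed
  have "\<exists>u. f {i} = sym_diff (f {}) {u}" if "i \<in> K" for i
    using adj'[of i "{}"] that by simp
  \<comment> \<open>\<open>d i\<close> is the element toggled in the image when coordinate
    \<open>i\<close> is flipped at the empty set.\<close>
  then obtain d where d: "\<And>i. i \<in> K \<Longrightarrow> f {i} = sym_diff (f {}) {d i}" by metis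
  have injd: "inj_on d K"
  proof (rule inj_onI)
    fix i j assume "i \<in> K" "j \<in> K" "d i = d j"
    then have "f {i} = f {j}" using d by simp
    then show "i = j" using inj \<open>i \<in> K\<close> \<open>j \<in> K\<close> by (auto dest: inj_onD)
  qed
  \<comment> \<open>Strong induction, since the step uses \<open>B\<close> without \<open>i\<close>,
    without \<open>j\<close>, and without both.\<close>
  have f: "f B = sym_diff (f {}) (d ` B)" if "B \<subseteq> K" for B
    using finite_subset[OF that K] that
  proof (induction B rule: finite_psubset_induct)
    case (psubset B)
    show ?case
    proof (cases "B = {} \<or> (\<exists>i. B = {i})")
      case True
      then show ?thesis using d psubset.prems by auto
    next
      case False
      then obtain i where i: "i \<in> B" by blast
      with False obtain j where j: "j \<in> B" "j \<noteq> i" by blast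
      \<comment> \<open>\<open>f (B - {i})\<close> and \<open>f (B - {j})\<close> have two common
        neighbours: \<open>?P\<close>, the image of \<open>?B\<close>, and the set claimed for
        \<open>f B\<close>.\<close>
      let ?B = "B - {i, j}" and ?P = "sym_diff (f {}) (d ` (B - {i, j}))"
      have d_ij: "d i \<notin> d ` ?B" "d j \<notin> d ` ?B" "d i \<noteq> d j"
        using i j psubset.prems inj_onD[OF injd] by blast+
      have ins: "insert i ?B = B - {j}" "insert j ?B = B - {i}"
        "insert j (B - {j}) = B" "insert i (B - {i}) = B" using i j by auto
      have IH: "f C = sym_diff (f {}) (d ` C)" if "C \<subset> B" for C
        by (rule psubset.IH[OF that]) (use that psubset.prems in blast)
      have P: "f ?B = ?P" by (rule IH) (use i in blast)
      have img: "d ` (B - {j}) = insert (d i) (d ` ?B)" "d ` (B - {i}) = insert (d j) (d ` ?B)"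
        unfolding ins(1,2)[symmetric] by simp_all
      have "f (B - {j}) = sym_diff (f {}) (insert (d i) (d ` ?B))"
        unfolding img(1)[symmetric] by (rule IH) (use j in blast)
      then have fi: "f (B - {j}) = sym_diff ?P {d i}" unfolding sym_diff_insert[OF d_ij(1)] .
      have "f (B - {i}) = sym_diff (f {}) (insert (d j) (d ` ?B))"
        unfolding img(2)[symmetric] by (rule IH) (use i in blast)
      then have fj: "f (B - {i}) = sym_diff ?P {d j}" unfolding sym_diff_insert[OF d_ij(2)] .
      obtain u where u: "f B = sym_diff (f (B - {j})) {u}"
        using adj'[of j "B - {j}"] psubset.prems ins by auto
      obtain v where v: "f B = sym_diff (f (B - {i})) {v}"
        using adj'[of i "B - {i}"] psubset.prems ins by auto
      \<comment> \<open>Injectivity of \<open>f\<close> excludes the neighbour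
        \<open>?P\<close>.\<close>
      have ne: "f B \<noteq> ?P"
        unfolding P[symmetric] using inj_onD[OF inj, of B ?B] psubset.prems i by blast
      have "sym_diff (sym_diff ?P {d i}) {u} = sym_diff (sym_diff ?P {d j}) {v}"
        using u v unfolding fi fj by (rule trans[OF sym])
      note nb = sym_diff_common_neighbour[OF this d_ij(3)]
      have uj: "u = d j" using nb ne unfolding u fi by iprover
      have dB: "d ` B = insert (d j) (insert (d i) (d ` ?B))" using i j by blast
      have dj: "d j \<notin> insert (d i) (d ` ?B)" using d_ij by (metis insert_iff)
      show ?thesis
        unfolding dB sym_diff_insert[OF dj] sym_diff_insert[OF d_ij(1)]
        using u unfolding fi uj .
    qed
  qed
  have "f ` Pow K = sym_diff (f {}) ` Pow (d ` K)"
  proof -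
    have "f ` Pow K = (\<lambda>B. sym_diff (f {}) (d ` B)) ` Pow K"
      by (intro image_cong refl) (use f in blast)
    also have "\<dots> = sym_diff (f {}) ` ((`) d ` Pow K)" by (simp only: image_image)
    also have "(`) d ` Pow K = Pow (d ` K)" by (rule image_Pow_surj[OF refl])
    finally show ?thesis .
  qed
  then have "f ` Pow K = subcube (f {} - d ` K) (d ` K)" by (simp only: sym_diff_subcube)
  moreover have "card (d ` K) = card K" using injd by (rule card_image)
  ultimately show ?thesis by blast
qed

section \<open>Induced subgraphs and isomorphisms of pair digraphs\<close>

definition induced_on :: "'a pair_pre_digraph \<Rightarrow> 'a set \<Rightarrow> 'a pair_pre_digraph" where
  "induced_on G V = \<lparr> pverts = V, parcs = Restr (parcs G) V \<rparr>"

lemma induced_on_simps [simp]: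
  "pverts (induced_on G V) = V" "parcs (induced_on G V) = Restr (parcs G) V"
  by (simp_all add: induced_on_def)

lemma wf_digraph_with_proj: "wf_digraph (with_proj G) \<longleftrightarrow> parcs G \<subseteq> pverts G \<times> pverts G"
  by (auto simp: wf_digraph_def)

text \<open>Compatibility fixes \<open>tail\<close> and \<open>head\<close> as the projections and
  inducedness fixes the arcs, so the vertex set determines the whole record
  \<open>H\<close>.\<close>

lemma induced_subgraph_with_proj_iff:
  assumes "wf_digraph (with_proj G)"
  shows "induced_subgraph H (with_proj G) \<longleftrightarrow> (\<exists>V\<subseteq>pverts G. H = with_proj (induced_on G V))"
proof
  assume H: "induced_subgraph H (with_proj G)"
  then have "verts H \<subseteq> pverts G" "tail H = fst" "head H = snd"
    and "arcs H = Restr (parcs G) (verts H)"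
    by (auto simp: induced_subgraph_def subgraph_def compatible_def)
  then have "H = with_proj (induced_on G (verts H))"
    by (intro pre_digraph.equality) auto
  then show "\<exists>V\<subseteq>pverts G. H = with_proj (induced_on G V)"
    using \<open>verts H \<subseteq> pverts G\<close> by blast
next
  assume "\<exists>V\<subseteq>pverts G. H = with_proj (induced_on G V)"
  then show "induced_subgraph H (with_proj G)"
    using assms by (auto simp: induced_subgraph_def subgraph_def compatible_def wf_digraph_with_proj)
qed

text \<open>An arc is the pair of its ends, so \<open>f\<close> forces the action
  \<open>map_prod f f\<close> on arcs.\<close>

lemma digraph_iso_with_projI:
  assumes "wf_digraph (with_proj G)" "wf_digraph (with_proj H)"
    and bij: "bij_betw f (pverts G) (pverts H)"
    and adj: "\<And>u v. u \<in> pverts G \<Longrightarrow> v \<in> pverts G \<Longrightarrow>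
      (u, v) \<in> parcs G \<longleftrightarrow> (f u, f v) \<in> parcs H"
  shows "digraph_iso (with_proj G) (with_proj H)"
proof -
  let ?h = "\<lparr> iso_verts = f, iso_arcs = map_prod f f, iso_head = snd, iso_tail = fst \<rparr>"
  have G: "parcs G \<subseteq> pverts G \<times> pverts G" and H: "parcs H \<subseteq> pverts H \<times> pverts H"
    using assms(1,2) by (simp_all add: wf_digraph_with_proj)
  have inj: "inj_on f (pverts G)" and img: "f ` pverts G = pverts H"
    using bij by (auto simp: bij_betw_def)
  have "inj_on (map_prod f f) (parcs G)"
    by (rule inj_on_subset[OF map_prod_inj_on[OF inj inj] G])
  then have "pre_digraph.digraph_isomorphism (with_proj G) ?h"
    using assms(1) inj by (auto simp: pre_digraph.digraph_isomorphism_def)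
  moreover have "map_prod f f ` parcs G = parcs H"
  proof
    show "map_prod f f ` parcs G \<subseteq> parcs H" using adj G by auto
    show "parcs H \<subseteq> map_prod f f ` parcs G"
    proof clarify
      fix a b assume ab: "(a, b) \<in> parcs H"
      then obtain u v where "u \<in> pverts G" "v \<in> pverts G" "a = f u" "b = f v"
        using H img by blast
      then show "(a, b) \<in> map_prod f f ` parcs G"
        using adj ab by (intro image_eqI[of _ _ "(u, v)"]) auto
    qed
  qed
  then have "with_proj H = app_iso ?h (with_proj G)"
    by (intro pre_digraph.equality) (simp_all add: img)
  ultimately show ?thesis unfolding digraph_iso_def by blast
qed

text \<open>The isomorphism is inverted: with a hypercube as \<open>H\<close>, the map then starts
  at the hypercube, as \<open>hypercube_embedding\<close> wants.\<close>

lemma digraph_iso_with_projD: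
  assumes "digraph_iso (with_proj G) (with_proj H)" and wf: "wf_digraph (with_proj H)"
  obtains f where "bij_betw f (pverts H) (pverts G)"
    "\<And>u v. (u, v) \<in> parcs H \<Longrightarrow> (f u, f v) \<in> parcs G"
proof -
  obtain h where h: "pre_digraph.digraph_isomorphism (with_proj G) h"
    and H: "with_proj H = app_iso h (with_proj G)"
    using assms(1) unfolding digraph_iso_def by blast
  \<comment> \<open>Equality with a \<open>with_proj\<close> record forces the head and tail
    functions carried by \<open>h\<close> to be the projections.\<close>
  have simps: "pverts H = iso_verts h ` pverts G" "parcs H = iso_arcs h ` parcs G"
      "fst = iso_tail h" "snd = iso_head h"
    using arg_cong[OF H, of verts] arg_cong[OF H, of arcs] arg_cong[OF H, of tail]
      arg_cong[OF H, of head] by simp_all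
  have inj: "inj_on (iso_verts h) (pverts G)"
    and ends: "\<And>e. e \<in> parcs G \<Longrightarrow> iso_verts h (fst e) = fst (iso_arcs h e)"
       "\<And>e. e \<in> parcs G \<Longrightarrow> iso_verts h (snd e) = snd (iso_arcs h e)"
    and wfG: "parcs G \<subseteq> pverts G \<times> pverts G"
    using h unfolding pre_digraph.digraph_isomorphism_def simps(3,4)[symmetric]
    by (simp_all add: wf_digraph_with_proj)
  let ?f = "the_inv_into (pverts G) (iso_verts h)"
  have "bij_betw ?f (pverts H) (pverts G)"
    unfolding simps by (rule bij_betw_the_inv_into[OF inj_on_imp_bij_betw[OF inj]])
  moreover have "(?f u, ?f v) \<in> parcs G" if uv: "(u, v) \<in> parcs H" for u v
  proof -
    obtain a b where ab: "(a, b) \<in> parcs G" "iso_arcs h (a, b) = (u, v)"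
      using uv simps(2) by auto
    then have "iso_verts h a = u" "iso_verts h b = v" using ends[OF ab(1)] by simp_all
    moreover have "a \<in> pverts G" "b \<in> pverts G" using ab(1) wfG by auto
    ultimately show ?thesis using ab(1) inj by (auto simp: the_inv_into_f_f)
  qed
  ultimately show ?thesis using that by blast
qed

lemma wf_hypercube: "wf_digraph (with_proj (hypercube k))"
  by (auto simp: wf_digraph_with_proj hypercube_def)

lemma wf_fence_graph: "wf_digraph (with_proj (fence_graph n))"
  by (auto simp: wf_digraph_with_proj parcs_fence_graph)

text \<open>Numbering the directions by \<open>h\<close> turns a vertex \<open>X\<close> into the
  binary word given by the image of \<open>X \<inter> D\<close>. Vertices differ only inside
  \<open>D\<close>, where \<open>h\<close> is injective, so the size of symmetric differences is
  preserved.\<close>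

lemma induced_on_subcube_iso:
  assumes D: "finite D" "card D = k" and AD: "A \<inter> D = {}" and sub: "subcube A D \<subseteq> pverts G"
    and G: "parcs G = {(X, Y). X \<in> pverts G \<and> Y \<in> pverts G \<and> card (sym_diff X Y) = 1}"
  shows "digraph_iso (with_proj (induced_on G (subcube A D))) (with_proj (hypercube k))"
proof -
  obtain h where h: "bij_betw h D {..<k}"
    using D by (metis bij_betw_iff_card card_lessThan finite_lessThan)
  then have injh: "inj_on h D" and imgh: "h ` D = {..<k}" by (auto simp: bij_betw_def)
  let ?f = "\<lambda>X. h ` (X \<inter> D)"
  have X: "X = A \<union> (X \<inter> D)" if "X \<in> subcube A D" for X using that AD by (auto simp: subcube_def)
  have sd: "h ` sym_diff P Q = sym_diff (h ` P) (h ` Q)" if "P \<subseteq> D" "Q \<subseteq> D" for P Q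
    using that by (simp add: image_Un inj_on_image_set_diff[OF injh] Diff_subset subset_trans[OF Diff_subset])
  have card: "card (sym_diff (?f X) (?f Y)) = card (sym_diff X Y)"
    if "X \<in> subcube A D" "Y \<in> subcube A D" for X Y
  proof -
    have "sym_diff X Y = sym_diff (X \<inter> D) (Y \<inter> D)" using X[OF that(1)] X[OF that(2)] by blast
    moreover have "inj_on h (sym_diff (X \<inter> D) (Y \<inter> D))" by (rule inj_on_subset[OF injh]) blast
    ultimately show ?thesis using sd[of "X \<inter> D" "Y \<inter> D"] by (metis Int_lower2 card_image)
  qed
  have sub2: "?f X \<subseteq> {..<k}" for X using imgh by blast
  show ?thesis
  proof (rule digraph_iso_with_projI)
    show "wf_digraph (with_proj (induced_on G (subcube A D)))"
      by (auto simp: wf_digraph_with_proj)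
    show "wf_digraph (with_proj (hypercube k))" by (rule wf_hypercube)
    show "bij_betw ?f (pverts (induced_on G (subcube A D))) (pverts (hypercube k))"
      unfolding bij_betw_def
    proof
      show "inj_on ?f (pverts (induced_on G (subcube A D)))"
      proof (rule inj_onI, simp)
        fix X Y assume XY: "X \<in> subcube A D" "Y \<in> subcube A D" "?f X = ?f Y"
        then have "X \<inter> D = Y \<inter> D" using inj_on_image_eq_iff[OF injh, of "X \<inter> D" "Y \<inter> D"] by simp
        then show "X = Y" using X[OF XY(1)] X[OF XY(2)] by simp
      qed
      have "B \<in> ?f ` subcube A D" if "B \<subseteq> {..<k}" for B
      proof -
        have "B \<subseteq> h ` D" using that imgh by simp
        then obtain E where E: "E \<subseteq> D" "B = h ` E" by (metis subset_image_iff)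
        then have "B = ?f (A \<union> E)" using AD by (intro E(2)[THEN trans] arg_cong[of _ _ "(`) h"]) blast
        moreover have "A \<union> E \<in> subcube A D" using E by (auto simp: subcube_def)
        ultimately show ?thesis by blast
      qed
      then show "?f ` pverts (induced_on G (subcube A D)) = pverts (hypercube k)"
        using sub2 by (auto simp: hypercube_def)
    qed
    fix X Y
    assume "X \<in> pverts (induced_on G (subcube A D))" "Y \<in> pverts (induced_on G (subcube A D))"
    then have XY: "X \<in> subcube A D" "Y \<in> subcube A D" by simp_all
    then have "X \<in> pverts G" "Y \<in> pverts G" using sub by auto
    then show "(X, Y) \<in> parcs (induced_on G (subcube A D)) \<longleftrightarrow> (?f X, ?f Y) \<in> parcs (hypercube k)"
      using card[OF XY] XY sub2 by (simp add: G hypercube_def)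
  qed
qed

text \<open>The intersection of all vertices is \<open>A\<close> and their union is
  \<open>A \<union> D\<close>; disjointness then recovers \<open>D\<close>.\<close>

lemma subcube_inject:
  assumes "subcube A D = subcube B E" "A \<inter> D = {}" "B \<inter> E = {}"
  shows "A = B \<and> D = E"
proof -
  have "\<Inter>(subcube A D) = A" "\<Union>(subcube A D) = A \<union> D" for A D :: "'a set"
    by (auto simp: subcube_def)
  then show ?thesis using assms by (metis Diff_cancel Un_Diff Un_Diff_Int Diff_triv Int_commute sup_bot_left)
qed

text \<open>Inducing on the subcube of \<open>(A, D)\<close> is a bijection: injective by
  \<open>subcube_inject\<close>, with hypercubes as values by \<open>induced_on_subcube_iso\<close>,
  and onto by \<open>hypercube_embedding\<close>.\<close>

lemma cube_count_eq_card_cubes: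
  "cube_count n k = card {(A, D) \<in> cubes (fence_filters n). card D = k}"
proof -
  let ?G = "fence_graph n" and ?C = "{(A, D) \<in> cubes (fence_filters n). card D = k}"
  let ?g = "\<lambda>(A, D). with_proj (induced_on ?G (subcube A D))"
  let ?S = "{H. induced_subgraph H (with_proj ?G) \<and> digraph_iso H (with_proj (hypercube k))}"
  have G: "parcs ?G = {(X, Y). X \<in> pverts ?G \<and> Y \<in> pverts ?G \<and> card (sym_diff X Y) = 1}"
    by (simp add: parcs_fence_graph)
  have "inj_on ?g ?C"
  proof (rule inj_onI, clarify)
    fix A D B E
    assume C: "(A, D) \<in> cubes (fence_filters n)" "(B, E) \<in> cubes (fence_filters n)"
      and "with_proj (induced_on ?G (subcube A D)) = with_proj (induced_on ?G (subcube B E))"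
    then have "subcube A D = subcube B E" by (metis induced_on_simps(1) with_proj_simps(1))
    then show "A = B \<and> D = E" using C by (intro subcube_inject) (auto simp: cubes_def)
  qed
  moreover have img: "?g ` ?C = ?S"
  proof
    show "?g ` ?C \<subseteq> ?S"
    proof clarify
      fix A D assume C: "(A, D) \<in> cubes (fence_filters n)" "k = card D"
      then have sub: "subcube A D \<subseteq> pverts ?G" and AD: "A \<inter> D = {}" by (auto simp: cubes_def)
      \<comment> \<open>The top vertex is a filter, hence a subset of \<open>{1..n}\<close>; this
        makes \<open>D\<close> finite.\<close>
      have "A \<union> D \<in> fence_filters n" using sub by (auto simp: subcube_def)
      then have "finite D" unfolding fence_filters_def using finite_subset by fastforce
      then show "induced_subgraph (with_proj (induced_on ?G (subcube A D))) (with_proj ?G) \<and>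
        digraph_iso (with_proj (induced_on ?G (subcube A D))) (with_proj (hypercube (card D)))"
        using sub AD G induced_on_subcube_iso[of D _ A ?G]
        by (auto simp: induced_subgraph_with_proj_iff[OF wf_fence_graph])
    qed
    show "?S \<subseteq> ?g ` ?C"
    proof clarify
      fix H
      assume H: "induced_subgraph H (with_proj ?G)" "digraph_iso H (with_proj (hypercube k))"
      obtain V where V: "V \<subseteq> pverts ?G" "H = with_proj (induced_on ?G V)"
        using H(1) induced_subgraph_with_proj_iff[OF wf_fence_graph] by blast
      obtain f where f: "bij_betw f (pverts (hypercube k)) (pverts (induced_on ?G V))"
        "\<And>A B. (A, B) \<in> parcs (hypercube k) \<Longrightarrow> (f A, f B) \<in> parcs (induced_on ?G V)"
        using digraph_iso_with_projD[OF H(2)[unfolded V(2)] wf_hypercube] by blast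
      then have bij: "bij_betw f (Pow {..<k}) V" by (simp add: hypercube_def)
      have adj: "card (sym_diff (f A) (f B)) = 1"
        if "A \<subseteq> {..<k}" "B \<subseteq> {..<k}" "card (sym_diff A B) = 1" for A B
        using f(2)[of A B] that by (simp add: G hypercube_def)
      obtain A D where AD: "A \<inter> D = {}" "card D = k" "f ` Pow {..<k} = subcube A D"
        using hypercube_embedding[OF finite_lessThan bij_betw_imp_inj_on[OF bij] adj]
        unfolding card_lessThan by blast
      then have "V = subcube A D" using bij by (simp add: bij_betw_def)
      then show "H \<in> ?g ` ?C"
        using V AD by (intro image_eqI[of _ _ "(A, D)"]) (auto simp: cubes_def)
    qed
  qed
  ultimately show ?thesis unfolding cube_count_def img[symmetric] by (intro card_image)
qed

section \<open>Filters of the fence\<close>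

text \<open>Closure under the generating relations propagates along chains by induction. Upper ends
  of covers are at least 1, so \<open>j \<le> n\<close> is the only bound left to check.\<close>

lemma fence_filters_iff:
  "F \<in> fence_filters n \<longleftrightarrow>
     F \<subseteq> {1..n} \<and> (\<forall>i j. (i, j) \<in> fence_covers \<longrightarrow> i \<in> F \<longrightarrow> j \<le> n \<longrightarrow> j \<in> F)"
proof -
  let ?R = "Restr fence_covers {1..n}"
  have pos: "1 \<le> j" if "(i, j) \<in> fence_covers" for i j
    using that by (auto simp: fence_covers_def)
  have "(\<forall>i\<in>F. \<forall>j. (i, j) \<in> fence_le n \<longrightarrow> j \<in> F) \<longleftrightarrow>
      (\<forall>i j. (i, j) \<in> fence_covers \<longrightarrow> i \<in> F \<longrightarrow> j \<le> n \<longrightarrow> j \<in> F)" (is "?L \<longleftrightarrow> ?C")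
    if F: "F \<subseteq> {1..n}"
  proof
    assume L: ?L
    show ?C
    proof (intro allI impI)
      fix i j assume ij: "(i, j) \<in> fence_covers" "i \<in> F" "j \<le> n"
      then have "(i, j) \<in> ?R" using F pos[OF ij(1)] by auto
      then have "(i, j) \<in> fence_le n" unfolding fence_le_def by blast
      then show "j \<in> F" using L ij by blast
    qed
  next
    assume C: ?C
    show ?L
    proof (intro ballI allI impI)
      fix i j assume "i \<in> F" "(i, j) \<in> fence_le n"
      then have "(i, j) \<in> ?R\<^sup>*" "i \<in> F" by (simp_all add: fence_le_def)
      then show "j \<in> F" by (induction rule: rtrancl_induct) (use C in auto)
    qed
  qed
  then show ?thesis unfolding fence_filters_def by auto
qed

text \<open>Trading the indexed union for parity and neighbouring indices reduces questions about
  covers to arithmetic.\<close>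

lemma mem_fence_covers:
  "(i, j) \<in> fence_covers \<longleftrightarrow> i = 2 \<and> j = 1 \<or> i = 3 \<and> j = 2 \<or> i = 2 \<and> j = 4 \<or> i = 5 \<and> j = 4
    \<or> 6 \<le> j \<and> even j \<and> (j = Suc i \<or> i = Suc j)"
proof -
  have "(\<exists>m\<in>{3..}. (i, j) \<in> {(2*m - 1, 2*m), (2*m + 1, 2*m)})
    \<longleftrightarrow> 6 \<le> j \<and> even j \<and> (j = Suc i \<or> i = Suc j)"
  proof
    assume "6 \<le> j \<and> even j \<and> (j = Suc i \<or> i = Suc j)"
    then show "\<exists>m\<in>{3..}. (i, j) \<in> {(2*m - 1, 2*m), (2*m + 1, 2*m)}"
      by (intro bexI[of _ "j div 2"]) auto
  qed auto
  then show ?thesis unfolding fence_covers_def by auto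
qed

lemma finite_Union_fence_filters: "finite (\<Union>(fence_filters n))"
  by (rule finite_subset[of _ "{1..n}"]) (auto simp: fence_filters_def)

lemma mem_fence_filter_le: "F \<in> fence_filters n \<Longrightarrow> i \<in> F \<Longrightarrow> i \<le> n"
  by (auto simp: fence_filters_def)

section \<open>Recurrences from adding a maximal or a minimal element\<close>

abbreviation "fence_poly n \<equiv> family_cube_poly (fence_filters n)"

text \<open>Adding a maximal \<open>a\<close> to a filter leaves a filter, so the deletion lies in
  the link. The deletion is then also the intersection and is counted with weight 1 + x.\<close>

lemma fence_poly_add_maximal:
  assumes "{X \<in> fence_filters n. a \<notin> X} = fence_filters l"
    "{X. a \<notin> X \<and> insert a X \<in> fence_filters n} = fence_filters m"
    "fence_filters l \<subseteq> fence_filters m"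
  shows "fence_poly n = fence_poly m + [:1, 1:] * fence_poly l"
  using family_cube_poly_split[OF finite_Union_fence_filters assms(1,2)[symmetric]]
  by (simp add: Int_absorb2[OF assms(3)] algebra_simps)

text \<open>Dually, removing a minimal \<open>a\<close> from a filter leaves a filter, so the link
  lies in the deletion and gets the weight 1 + x.\<close>

lemma fence_poly_add_minimal:
  assumes "{X \<in> fence_filters n. a \<notin> X} = fence_filters m"
    "{X. a \<notin> X \<and> insert a X \<in> fence_filters n} = \<G>"
    "\<G> \<subseteq> fence_filters m"
  shows "fence_poly n = fence_poly m + [:1, 1:] * family_cube_poly \<G>"
  using family_cube_poly_split[OF finite_Union_fence_filters assms(1,2)[symmetric]]
  by (simp add: Int_absorb1[OF assms(3)] algebra_simps)

text \<open>The hypothesis makes \<open>Suc n\<close> minimal, so no closure condition ever forces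
  it into a filter.\<close>

lemma minimal_notin_filters:
  assumes "\<And>i. i \<le> n \<Longrightarrow> (i, Suc n) \<notin> fence_covers"
  shows "{X \<in> fence_filters (Suc n). Suc n \<notin> X} = fence_filters n"
proof (intro set_eqI iffI)
  fix X assume "X \<in> {X \<in> fence_filters (Suc n). Suc n \<notin> X}"
  then show "X \<in> fence_filters n"
    unfolding fence_filters_iff by (auto simp: le_Suc_eq)
next
  fix X assume X: "X \<in> fence_filters n"
  then have "X \<subseteq> {1..n}" by (simp add: fence_filters_iff)
  then show "X \<in> {X \<in> fence_filters (Suc n). Suc n \<notin> X}"
    using X assms unfolding fence_filters_iff by (fastforce simp: le_Suc_eq)
qed

text \<open>The hypothesis makes \<open>Suc n\<close> maximal: its presence demands nothing and
  satisfies every condition that would force it.\<close>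

lemma insert_maximal_filters:
  assumes "\<And>j. j \<le> Suc n \<Longrightarrow> (Suc n, j) \<notin> fence_covers"
  shows "{X. Suc n \<notin> X \<and> insert (Suc n) X \<in> fence_filters (Suc n)} = fence_filters n"
proof (intro set_eqI iffI)
  fix X assume "X \<in> {X. Suc n \<notin> X \<and> insert (Suc n) X \<in> fence_filters (Suc n)}"
  then have sub: "X \<subseteq> {1..Suc n}" and a: "Suc n \<notin> X" and C: "\<And>i j. (i, j) \<in> fence_covers \<Longrightarrow>
      i \<in> insert (Suc n) X \<Longrightarrow> j \<le> Suc n \<Longrightarrow> j \<in> insert (Suc n) X"
    unfolding fence_filters_iff by blast+
  have "X \<subseteq> {1..n}" using sub a by (auto simp: le_Suc_eq)
  moreover have "j \<in> X" if "(i, j) \<in> fence_covers" "i \<in> X" "j \<le> n" for i j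
    using C[OF that(1)] that by auto
  ultimately show "X \<in> fence_filters n" unfolding fence_filters_iff by blast
next
  fix X assume X: "X \<in> fence_filters n"
  then have "Suc n \<notin> X" by (auto dest: mem_fence_filter_le)
  then show "X \<in> {X. Suc n \<notin> X \<and> insert (Suc n) X \<in> fence_filters (Suc n)}"
    using X assms unfolding fence_filters_iff by (auto simp: le_Suc_eq)
qed

text \<open>By the second hypothesis, \<open>{1..l}\<close> is an up-set of the fence on
  \<open>m\<close> elements, and up-sets of an up-set are up-sets.\<close>

lemma fence_filters_mono:
  assumes "l \<le> m" "\<And>i j. (i, j) \<in> fence_covers \<Longrightarrow> i \<le> l \<Longrightarrow> j \<le> m \<Longrightarrow> j \<le> l"
  shows "fence_filters l \<subseteq> fence_filters m"
proof
  fix X assume X: "X \<in> fence_filters l"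
  have "j \<in> X" if "(i, j) \<in> fence_covers" "i \<in> X" "j \<le> m" for i j
  proof -
    have "i \<le> l" using X that by (auto dest: mem_fence_filter_le)
    then have "j \<le> l" using that assms(2) by blast
    then show ?thesis using X that unfolding fence_filters_iff by blast
  qed
  moreover have "X \<subseteq> {1..m}" using X assms(1) by (auto simp: fence_filters_iff)
  ultimately show "X \<in> fence_filters m" unfolding fence_filters_iff by blast
qed

text \<open>The new element n+2 is maximal and lies above n+1. A filter without it also omits n+1
  and is a filter on \<open>n\<close> elements; a filter with it is any filter on n+1 elements plus
  the new one.\<close>

lemma fence_poly_even:
  assumes "even n" "n \<ge> 4"
  shows "fence_poly (Suc (Suc n)) = fence_poly (Suc n) + [:1, 1:] * fence_poly n"
proof (rule fence_poly_add_maximal)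
  let ?a = "Suc (Suc n)"
  \<comment> \<open>No element of index at most \<open>n\<close> lies below one of the two later
    elements.\<close>
  have closed: "j \<le> n" if "(i, j) \<in> fence_covers" "i \<le> n" "j \<le> ?a" for i j
    using that assms by (cases "i = n") (auto simp: mem_fence_covers)
  show "{X \<in> fence_filters ?a. ?a \<notin> X} = fence_filters n"
  proof (intro set_eqI iffI)
    fix X assume "X \<in> {X \<in> fence_filters ?a. ?a \<notin> X}"
    then have sub: "X \<subseteq> {1..?a}" and a: "?a \<notin> X"
      and C: "\<And>i j. (i, j) \<in> fence_covers \<Longrightarrow> i \<in> X \<Longrightarrow> j \<le> ?a \<Longrightarrow> j \<in> X"
      unfolding fence_filters_iff by blast+
    have "Suc n \<notin> X" using C[of "Suc n" ?a] a assms by (auto simp: mem_fence_covers)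
    then have "X \<subseteq> {1..n}" using sub a by (auto simp: le_Suc_eq)
    then show "X \<in> fence_filters n" unfolding fence_filters_iff using C by auto
  next
    fix X assume X: "X \<in> fence_filters n"
    then have "X \<in> fence_filters ?a" using fence_filters_mono[of n ?a] closed by auto
    then show "X \<in> {X \<in> fence_filters ?a. ?a \<notin> X}" using X by (auto dest: mem_fence_filter_le)
  qed
  show "{X. ?a \<notin> X \<and> insert ?a X \<in> fence_filters ?a} = fence_filters (Suc n)"
    using assms by (intro insert_maximal_filters) (auto simp: mem_fence_covers)
  show "fence_filters n \<subseteq> fence_filters (Suc n)"
    using closed by (intro fence_filters_mono) auto
qed

text \<open>The new element n+1 is minimal and only \<open>n\<close> lies above it. A filter
  containing it contains \<open>n\<close>, which is maximal, and is otherwise any filter on n-1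
  elements; the constant member \<open>n\<close> is stripped by
  \<open>family_cube_poly_insert\<close>.\<close>

lemma fence_poly_odd:
  assumes "even n" "n \<ge> 4"
  shows "fence_poly (Suc n) = fence_poly n + [:1, 1:] * fence_poly (n - 1)"
proof -
  have up: "j = n" if "(Suc n, j) \<in> fence_covers" "j \<le> Suc n" for j
    using that assms by (auto simp: mem_fence_covers)
  have down: "(Suc n, n) \<in> fence_covers" using assms by (auto simp: mem_fence_covers)
  have max: False if "(n, j) \<in> fence_covers" for j
    using that assms by (auto simp: mem_fence_covers)
  have F1: "{X. Suc n \<notin> X \<and> insert (Suc n) X \<in> fence_filters (Suc n)} =
      insert n ` fence_filters (n - 1)"
  proof (intro set_eqI iffI)
    fix X assume "X \<in> {X. Suc n \<notin> X \<and> insert (Suc n) X \<in> fence_filters (Suc n)}"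
    then have sub: "X \<subseteq> {1..Suc n}" and a: "Suc n \<notin> X" and C: "\<And>i j. (i, j) \<in> fence_covers \<Longrightarrow>
        i \<in> insert (Suc n) X \<Longrightarrow> j \<le> Suc n \<Longrightarrow> j \<in> insert (Suc n) X"
      unfolding fence_filters_iff by blast+
    then have n: "n \<in> X" using C[OF down] by auto
    moreover have "X \<subseteq> {1..n}" using sub a by (auto simp: le_Suc_eq)
    then have "X - {n} \<subseteq> {1..n-1}" by force
    moreover have "j \<in> X - {n}" if "(i, j) \<in> fence_covers" "i \<in> X - {n}" "j \<le> n - 1" for i j
    proof -
      have "j \<le> Suc n" "j \<noteq> Suc n" "j \<noteq> n" using that(3) assms by auto
      then show ?thesis using C[OF that(1)] that(2) by blast
    qed
    ultimately have "X - {n} \<in> fence_filters (n - 1)" unfolding fence_filters_iff by blast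
    then show "X \<in> insert n ` fence_filters (n - 1)" using n by (metis image_eqI insert_Diff)
  next
    fix X assume "X \<in> insert n ` fence_filters (n - 1)"
    then obtain Y where X: "X = insert n Y" and "Y \<in> fence_filters (n - 1)" by blast
    then have Y: "Y \<subseteq> {1..n-1}"
      "\<And>i j. (i, j) \<in> fence_covers \<Longrightarrow> i \<in> Y \<Longrightarrow> j \<le> n - 1 \<Longrightarrow> j \<in> Y"
      unfolding fence_filters_iff by blast+
    have "j \<in> insert (Suc n) X"
      if "(i, j) \<in> fence_covers" "i \<in> insert (Suc n) X" "j \<le> Suc n" for i j
    proof (cases "i = Suc n \<or> i = n")
      case True
      then show ?thesis using up max that X by auto
    next
      case False
      then have "i \<in> Y" using that X by blast
      then show ?thesis using Y(2)[OF that(1)] that X by (cases "j \<le> n - 1") auto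
    qed
    moreover have "m \<in> {1..n-1}" if "m \<in> Y" for m using that Y(1) by blast
    then have "insert (Suc n) X \<subseteq> {1..Suc n}" "Suc n \<notin> X" using X assms by force+
    ultimately show "X \<in> {X. Suc n \<notin> X \<and> insert (Suc n) X \<in> fence_filters (Suc n)}"
      unfolding fence_filters_iff by blast
  qed
  have sub: "insert n ` fence_filters (n - 1) \<subseteq> fence_filters n"
  proof clarify
    fix Y assume Y: "Y \<in> fence_filters (n - 1)"
    then have "j \<in> insert n Y" if "(i, j) \<in> fence_covers" "i \<in> insert n Y" "j \<le> n" for i j
      using max that unfolding fence_filters_iff by (cases "j \<le> n - 1") auto
    moreover have "insert n Y \<subseteq> {1..n}"
    proof -
      have "Y \<subseteq> {1..n-1}" using Y by (simp add: fence_filters_iff)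
      moreover have "{1..n-1} \<subseteq> {1..n}" "n \<in> {1..n}" using assms by auto
      ultimately show ?thesis by blast
    qed
    ultimately show "insert n Y \<in> fence_filters n" unfolding fence_filters_iff by blast
  qed
  have "{X \<in> fence_filters (Suc n). Suc n \<notin> X} = fence_filters n"
    using assms by (intro minimal_notin_filters) (auto simp: mem_fence_covers)
  then have "fence_poly (Suc n) = fence_poly n + [:1, 1:] *
      family_cube_poly (insert n ` fence_filters (n - 1))"
    using F1 sub by (rule fence_poly_add_minimal)
  also have "family_cube_poly (insert n ` fence_filters (n - 1)) = fence_poly (n - 1)"
    using assms by (intro family_cube_poly_insert finite_Union_fence_filters)
      (auto dest: mem_fence_filter_le)
  finally show ?thesis .
qed

text \<open>Parity decides whether the last element is maximal or minimal, and both cases give the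
  same formula. For odd \<open>n\<close> the odd case is applied at \<open>Suc n\<close>, which
  admits \<open>n = 3\<close>.\<close>

lemma fence_poly_rec:
  assumes "n \<ge> 3"
  shows "fence_poly (Suc (Suc n)) = fence_poly (Suc n) + [:1, 1:] * fence_poly n"
  using fence_poly_even[of n] fence_poly_odd[of "Suc n"] assms by (cases "even n") auto

section \<open>Initial values and the generating function\<close>

lemma fence_poly_0: "fence_poly 0 = 1"
proof -
  have "fence_filters 0 = {{}}" by (auto simp: fence_filters_iff)
  then show ?thesis by (simp add: family_cube_poly_singleton)
qed

text \<open>Up to three elements the fence is a chain with bottom \<open>n\<close>, so the only
  filter containing \<open>n\<close> is everything, and the link is a single set.\<close>

lemma fence_poly_chain:
  assumes "1 \<le> n" "n \<le> 3"
  shows "fence_poly n = fence_poly (n - 1) + [:1, 1:]"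
proof -
  have n: "n = 1 \<or> n = 2 \<or> n = 3" using assms by auto
  then have "{X \<in> fence_filters n. n \<notin> X} = fence_filters (n - 1)"
    using minimal_notin_filters[of "n - 1"] assms by (auto simp: mem_fence_covers)
  moreover have "{X. n \<notin> X \<and> insert n X \<in> fence_filters n} = {{1..n-1}}"
  proof (intro set_eqI iffI)
    fix X assume "X \<in> {X. n \<notin> X \<and> insert n X \<in> fence_filters n}"
    then have sub: "X \<subseteq> {1..n}" and a: "n \<notin> X" and C: "\<And>i j. (i, j) \<in> fence_covers \<Longrightarrow>
        i \<in> insert n X \<Longrightarrow> j \<le> n \<Longrightarrow> j \<in> insert n X"
      unfolding fence_filters_iff by blast+
    have "m \<in> X" if "m \<in> {1..n-1}" for m
    proof -
      have "m = 1 \<and> (n = 2 \<or> n = 3) \<or> m = 2 \<and> n = 3" using that n by auto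
      then show ?thesis using C[of 2 1] C[of 3 2] by (auto simp: mem_fence_covers)
    qed
    moreover have "m \<in> {1..n-1}" if "m \<in> X" for m
    proof -
      have "m \<in> {1..n}" "m \<noteq> n" using sub a that by auto
      then show ?thesis by auto
    qed
    ultimately show "X \<in> {{1..n-1}}" by blast
  next
    fix X assume "X \<in> {{1..n-1}}"
    then have X: "X = {1..n-1}" by simp
    then have "insert n X = {1..n}" using assms by auto
    then show "X \<in> {X. n \<notin> X \<and> insert n X \<in> fence_filters n}"
      using X assms by (auto simp: fence_filters_iff mem_fence_covers)
  qed
  moreover have "{{1..n-1}} \<subseteq> fence_filters (n - 1)"
    by (auto simp: fence_filters_iff mem_fence_covers)
  ultimately have "fence_poly n = fence_poly (n - 1) + [:1, 1:] * family_cube_poly {{1..n-1}}"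
    by (rule fence_poly_add_minimal)
  then show ?thesis by (simp add: family_cube_poly_singleton)
qed

text \<open>Element 4 is maximal and lies above 2 and hence 3, so a filter without it lives on
  \<open>{1}\<close>. This is why \<open>fence_poly 1\<close> appears where the general recurrence
  would have \<open>fence_poly 2\<close>.\<close>

lemma fence_poly_4: "fence_poly 4 = fence_poly 3 + [:1, 1:] * fence_poly 1"
proof (rule fence_poly_add_maximal)
  show "{X \<in> fence_filters 4. 4 \<notin> X} = fence_filters 1"
  proof (intro set_eqI iffI)
    fix X :: "nat set" assume "X \<in> {X \<in> fence_filters 4. 4 \<notin> X}"
    then have sub: "X \<subseteq> {1..4}" and a: "4 \<notin> X"
      and C: "\<And>i j. (i, j) \<in> fence_covers \<Longrightarrow> i \<in> X \<Longrightarrow> j \<le> 4 \<Longrightarrow> j \<in> X"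
      unfolding fence_filters_iff by blast+
    have "2 \<notin> X" using a C[of 2 4] by (auto simp: mem_fence_covers)
    moreover from this have "3 \<notin> X" using C[of 3 2] by (auto simp: mem_fence_covers)
    moreover have "{1..4} = {1, 2, 3, 4 :: nat}" by auto
    ultimately have "X \<subseteq> {1}" using sub a by blast
    then show "X \<in> fence_filters 1" by (auto simp: fence_filters_iff mem_fence_covers)
  next
    fix X assume X: "X \<in> fence_filters 1"
    then have "X \<in> fence_filters 4"
      using fence_filters_mono[of 1 4] by (auto simp: mem_fence_covers)
    then show "X \<in> {X \<in> fence_filters 4. 4 \<notin> X}"
      using X by (auto dest: mem_fence_filter_le)
  qed
  show "{X. 4 \<notin> X \<and> insert 4 X \<in> fence_filters 4} = fence_filters 3"
    using insert_maximal_filters[of 3] by (simp add: mem_fence_covers)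
  show "fence_filters 1 \<subseteq> fence_filters 3"
    by (intro fence_filters_mono) (auto simp: mem_fence_covers)
qed

lemma fence_poly_values:
  "fence_poly 1 = [:2, 1:]" "fence_poly 2 = [:3, 2:]" "fence_poly 3 = [:4, 3:]"
  "fence_poly 4 = [:6, 6, 1:]"
proof -
  show 1: "fence_poly 1 = [:2, 1:]" using fence_poly_chain[of 1] by (simp add: fence_poly_0 one_pCons)
  show 2: "fence_poly 2 = [:3, 2:]" using fence_poly_chain[of 2] 1 by simp
  show 3: "fence_poly 3 = [:4, 3:]" using fence_poly_chain[of 3] 2 by simp
  show "fence_poly 4 = [:6, 6, 1:]" using fence_poly_4 1 3 by simp
qed

text \<open>The left side is the coefficient of y^n in the series times the denominator, with 0 for
  negative indices. It vanishes at \<open>n = 2\<close> and for \<open>n \<ge> 5\<close>; at 3 and 4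
  the recurrence misses the true value by (1+x)^2.\<close>

lemma fence_poly_numerator:
  "fence_poly n - (if n < 1 then 0 else fence_poly (n - 1))
      - [:1, 1:] * (if n < 2 then 0 else fence_poly (n - 2))
    = (if n = 0 then 1 else 0) + [:1, 1:] * (if n = 1 then 1 else 0)
      - [:1, 1:]^2 * (if n = 3 then 1 else 0) - [:1, 1:]^2 * (if n = 4 then 1 else 0)"
proof -
  consider "n = 0" | "n = 1" | "n = 2" | "n = 3" | "n = 4" | "n \<ge> 5" by linarith
  then show ?thesis
  proof cases
    case 6
    define m where "m = n - 2"
    have "n = Suc (Suc m)" "m \<ge> 3" using 6 by (auto simp: m_def)
    then show ?thesis using fence_poly_rec[of m] by simp
  \<comment> \<open>The simplifier writes the index 1 as \<open>Suc 0\<close>, so the values are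
    supplied in that form as well.\<close>
  qed (simp_all add: fence_poly_0 fence_poly_values fence_poly_values[unfolded One_nat_def]
      one_pCons power2_eq_square)
qed

lemma cube_poly_eq_fence_poly: "cube_poly n = fence_poly n"
  by (rule poly_eqI)
    (simp add: coeff_cube_poly cube_count_eq_card_cubes
      coeff_family_cube_poly[OF finite_Union_fence_filters])

theorem theorem4:
  fixes x y :: "int poly fract fps"
  defines "x \<equiv> fps_const (to_fract [:0, 1:])" and "y \<equiv> fps_X"
  shows "Abs_fps (\<lambda>n. to_fract (cube_poly n)) =
    (1 + (1 + x) * y - (1 + x)^2 * y^3 - (1 + x)^2 * y^4) / (1 - y - (1 + x) * y^2)"
    (is "?S = ?N / ?D")
proof -
  \<comment> \<open>Keeping 1 + x as one constant \<open>c\<close> lets coefficient extraction treat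
    it as a scalar.\<close>
  define c :: "int poly fract" where "c = to_fract [:1, 1:]"
  have x: "1 + x = fps_const c"
  proof -
    have "[:1, 1:] = 1 + [:0, 1 :: int:]" by (simp add: one_pCons)
    then have "c = 1 + to_fract [:0, 1:]" unfolding c_def by (simp only: to_fract_add to_fract_1)
    then show ?thesis by (simp add: x_def)
  qed
  have "?S * ?D = ?N"
  proof (rule fps_ext)
    fix n
    have "?S * ?D = ?S - ?S * fps_X - fps_const c * (?S * fps_X^2)"
      unfolding x y_def by (simp add: algebra_simps)
    \<comment> \<open>Multiplication by \<open>y\<close> and \<open>y^2\<close> shifts coefficients,
      with 0 below the start. Products with \<open>[:1, 1:]\<close> stay unexpanded so that they
      match \<open>c\<close>.\<close>
    then have "(?S * ?D) $ n = to_fract (fence_poly n - (if n < 1 then 0 else fence_poly (n - 1))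
        - [:1, 1:] * (if n < 2 then 0 else fence_poly (n - 2)))"
      by (simp add: fps_X_power_mult_right_nth cube_poly_eq_fence_poly c_def del: mult_pCons_left mult_pCons_right)
    also have "\<dots> = ?N $ n"
      unfolding fence_poly_numerator x y_def
      by (simp add: fps_const_power fps_X_power_nth c_def power2_eq_square
          del: fps_const_power[symmetric] mult_pCons_left mult_pCons_right)
    finally show "(?S * ?D) $ n = ?N $ n" .
  qed
  \<comment> \<open>Constant coefficient 1 makes the denominator nonzero, so it cancels and the
    product identity becomes the quotient.\<close>
  moreover have "?D $ 0 = 1" by (simp add: y_def)
  then have "?D \<noteq> 0" by (metis fps_zero_nth zero_neq_one)
  ultimately show ?thesis by (metis nonzero_mult_div_cancel_right)
qed

end
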